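(* Let $R=R(q)$ be a Hecke symmetry on $V\otimes V$, $\dim_{\mathbb C}V=N$, which is a deformation of the usual flip $P$, let $r$ be the corresponding classical $r$-matrix, and consider on $\mathrm{Sym}(gl(N))=\mathbb C[l_i^j]_{1\le i,j\le N}$ the Poisson pencil $$a\,\{\,,\,\}_{gl(N)}+b\,\{\,,\,\}_r,\qquad a,b\in\mathbb C .$$ Then this Poisson pencil can be restricted to any generic $GL(N)$-orbit in $gl(N)^*$: for every generic orbit $\mathcal O\subset gl(N)^*$ and all $a,b\in\mathbb C$, the ideal of all polynomials in $\mathrm{Sym}(gl(N))$ vanishing on $\mathcal O$ is a Poisson ideal for the bracket $a\{\,,\,\}_{gl(N)}+b\{\,,\,\}_r$.
   Context: Let $V$ be a complex vector space of dimension $N$ with a fixed basis, and let $P$ be the usual flip on $V\otimes V$. A braiding is an operator $R:V^{\otimes2}\to V^{\otimes2}$ with $(R\otimes I)(I\otimes R)(R\otimes I)=(I\otimes R)(R\otimes I)(I\otimes R)$. A Hecke symmetry is a braiding with $(qI-R)(q^{-1}I+R)=0$, where $q\in\mathbb C^\times$, $q\ne\pm1$. "$R$ is a deformation of the usual flip" means that $R=R(q)$ depends on $q$ and tends to $P$ as $q\to1$. Putting $h=\log q$, the classical $r$-matrix $r=r_{12}$ is defined by $P_{12}R_{12}=I+h\,r_{12}+o(h)$, and $r_{21}=P_{12}r_{12}P_{12}$. It satisfies $[r_{12},r_{13}]+[r_{12},r_{23}]+[r_{13},r_{23}]=0$ and $r_{12}+r_{21}=2P_{12}$. $\mathrm{Sym}(gl(N))$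 is the polynomial algebra in the commuting variables $l_i^j$, regarded as linear functions on $gl(N)^*$; $L=\|l_i^j\|$, $L_1=L\otimes I$, $L_2=I\otimes L$. The bracket $\{\,,\,\}_r$ is the Poisson bracket given by $$\{L_1,L_2\}_r=r_{21}L_1L_2-L_1L_2r_{12}+L_2r_{12}L_1-L_1r_{21}L_2,$$ where $\{L_1,L_2\}_r$ is the matrix whose entries are the brackets $\{l_i^j,l_k^s\}_r$ (same placement of indices as in $L\otimes L$). The linear bracket is $\{l_i^j,l_k^s\}_{gl(N)}=l_i^s\delta_k^j-l_k^j\delta_i^s$. The two brackets are compatible, i.e. every linear combination $a\{\,,\,\}_{gl(N)}+b\{\,,\,\}_r$ is a Poisson bracket. Identifying points of $gl(N)^*$ with $N\times N$ complex matrices (the values of $L$), the $GL(N)$-orbits are the conjugacy classes. An orbit is generic if it is the orbit of a diagonal matrix with pairwise distinct eigenvalues $\mu_1,\dots,\mu_N$; it is then defined by the system $\mathrm{Tr}\,L^k=\sum_{i}\mu_i^k$, $1\le k\le N$. *)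

theory Defs
  imports "HOL-Analysis.Analysis" "HOL-Library.Poly_Mapping" "HOL-Library.Landau_Symbols"
begin

section \<open>Operators on tensor powers of V\<close>

text \<open>
  V has a fixed basis indexed by the finite type \<open>'n\<close>, so N is the cardinality of \<open>'n\<close>.
  Operators on the second and third tensor powers of V are identified with their matrices in
  the tensor bases, which are indexed by \<open>'n \<times> 'n\<close> and \<open>'n \<times> 'n \<times> 'n\<close>.
\<close>

type_synonym 'n op2 = "complex ^ ('n \<times> 'n) ^ ('n \<times> 'n)"
type_synonym 'n op3 = "complex ^ ('n \<times> 'n \<times> 'n) ^ ('n \<times> 'n \<times> 'n)"

definition kronecker :: "'a::times ^ 'm ^ 'm \<Rightarrow> 'a ^ 'n ^ 'n \<Rightarrow> 'a ^ ('m \<times> 'n) ^ ('m \<times> 'n)"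
  where "kronecker A B = (\<chi> p p'. A $ fst p $ fst p' * B $ snd p $ snd p')"

definition flip :: "'n::finite op2"
  where "flip = (\<chi> p p'. if fst p = snd p' \<and> snd p = fst p' then 1 else 0)"

text \<open>The operators \<open>R \<otimes> I\<close> and \<open>I \<otimes> R\<close>; the former needs a reassociation of the index type.\<close>

definition tensor_id :: "'n::finite op2 \<Rightarrow> 'n op3"
  where "tensor_id R = (\<chi> p p'. case p of (i, j, k) \<Rightarrow> case p' of (i', j', k') \<Rightarrow>
           R $ (i, j) $ (i', j') * mat 1 $ k $ k')"

definition id_tensor :: "'n::finite op2 \<Rightarrow> 'n op3"
  where "id_tensor R = kronecker (mat 1) R"

definition braiding :: "'n::finite op2 \<Rightarrow> bool"
  where "braiding R \<longleftrightarrow>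
     tensor_id R ** id_tensor R ** tensor_id R = id_tensor R ** tensor_id R ** id_tensor R"

definition hecke_symmetry :: "complex \<Rightarrow> 'n::finite op2 \<Rightarrow> bool"
  where "hecke_symmetry q R \<longleftrightarrow>
     q \<noteq> 0 \<and> q \<noteq> 1 \<and> q \<noteq> - 1 \<and> braiding R \<and>
     (mat q - R) ** (mat (inverse q) + R) = 0"

text \<open>
  A family of operators \<open>R q\<close>, with \<open>q\<close> ranging over a set \<open>Q\<close> of admissible parameters
  accumulating at 1 (for instance a punctured neighbourhood of 1, or a real interval with
  endpoint 1).
\<close>

definition deformation_of_flip :: "complex set \<Rightarrow> (complex \<Rightarrow> 'n::finite op2) \<Rightarrow> bool"
  where "deformation_of_flip Q R \<longleftrightarrow> 1 islimpt Q \<and> (R \<longlongrightarrow> flip) (at 1 within Q)"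

text \<open>\<open>P R(q) = I + h r + o(h)\<close> as \<open>q \<rightarrow> 1\<close>, where \<open>h = log q\<close>; the remainder is required to
  be \<open>o(h)\<close> in every matrix entry.\<close>

definition classical_r_matrix ::
    "complex set \<Rightarrow> (complex \<Rightarrow> 'n::finite op2) \<Rightarrow> 'n op2 \<Rightarrow> bool"
  where "classical_r_matrix Q R r \<longleftrightarrow>
     (\<forall>p p'. (\<lambda>q. (flip ** R q - (mat 1 + mat (Ln q) ** r)) $ p $ p')
               \<in> o[at 1 within Q](\<lambda>q. Ln q))"

section \<open>The algebra Sym(gl(N))\<close>

text \<open>
  Polynomials in the variables \<open>l_i^j\<close>, as finitely supported functions from monomials
  (exponent vectors) to coefficients. The variable \<open>l_i^j\<close> has index \<open>(i, j)\<close> and is the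
  entry of the generating matrix L in row \<open>i\<close> and column \<open>j\<close>.
\<close>

type_synonym 'n sym_gl = "(('n \<times> 'n) \<Rightarrow>\<^sub>0 nat) \<Rightarrow>\<^sub>0 complex"

definition const :: "complex \<Rightarrow> 'n sym_gl"
  where "const c = Poly_Mapping.single 0 c"

definition var :: "'n \<times> 'n \<Rightarrow> 'n sym_gl"
  where "var v = Poly_Mapping.single (Poly_Mapping.single v 1) 1"

definition eval_at :: "complex ^ 'n ^ 'n \<Rightarrow> 'n::finite sym_gl \<Rightarrow> complex"
  where "eval_at x f = (\<Sum>m \<in> Poly_Mapping.keys f.
     Poly_Mapping.lookup f m * (\<Prod>(i, j) \<in> UNIV. (x $ i $ j) ^ Poly_Mapping.lookup m (i, j)))"

definition partial :: "'n \<times> 'n \<Rightarrow> 'n sym_gl \<Rightarrow> 'n sym_gl"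
  where "partial v f =
     (\<Sum>m \<in> Poly_Mapping.keys f. Poly_Mapping.single (m - Poly_Mapping.single v 1)
        (of_nat (Poly_Mapping.lookup m v) * Poly_Mapping.lookup f m))"

text \<open>The biderivation of Sym(gl(N)) with prescribed values \<open>c u v\<close> on the pairs of generators;
  see the lemmas at the end of this section.\<close>

definition biderivation ::
    "('n \<times> 'n \<Rightarrow> 'n \<times> 'n \<Rightarrow> 'n sym_gl) \<Rightarrow> 'n::finite sym_gl \<Rightarrow> 'n sym_gl \<Rightarrow> 'n sym_gl"
  where "biderivation c f g = (\<Sum>u \<in> UNIV. \<Sum>v \<in> UNIV. partial u f * partial v g * c u v)"

lemma partial_superset:
  assumes "finite S" "Poly_Mapping.keys f \<subseteq> S"
  shows "partial v f =
     (\<Sum>m \<in> S. Poly_Mapping.single (m - Poly_Mapping.single v 1)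
        (of_nat (Poly_Mapping.lookup m v) * Poly_Mapping.lookup f m))"
  unfolding partial_def
  by (rule sum.mono_neutral_left) (use assms in \<open>auto simp: in_keys_iff\<close>)

lemma partial_add: "partial v (f + g) = partial v f + partial v g"
proof -
  let ?S = "Poly_Mapping.keys f \<union> Poly_Mapping.keys g"
  have S: "finite ?S" "Poly_Mapping.keys f \<subseteq> ?S" "Poly_Mapping.keys g \<subseteq> ?S"
      "Poly_Mapping.keys (f + g) \<subseteq> ?S"
    by (auto simp: keys_add)
  show ?thesis
    unfolding partial_superset[OF S(1,2)] partial_superset[OF S(1,3)] partial_superset[OF S(1,4)]
    by (simp add: lookup_add ring_distribs single_add sum.distrib)
qed

lemma partial_single:
  "partial v (Poly_Mapping.single m c) =
     Poly_Mapping.single (m - Poly_Mapping.single v 1) (of_nat (Poly_Mapping.lookup m v) * c)"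
  by (cases "c = 0") (auto simp: partial_def)

lemma partial_0 [simp]: "partial v 0 = 0"
  by (simp add: partial_def)

lemma partial_const [simp]: "partial v (const c) = 0"
  by (simp add: const_def partial_single)

lemma partial_var: "partial v (var u) = (if u = v then 1 else 0)"
  by (simp add: var_def partial_single lookup_single when_def)

lemma sym_gl_induct [case_names zero single add]:
  fixes f :: "'n sym_gl"
  assumes "P 0" "\<And>m c. P (Poly_Mapping.single m c)" "\<And>f g. P f \<Longrightarrow> P g \<Longrightarrow> P (f + g)"
  shows "P f"
proof (induction f rule: update_induct)
  case const
  then show ?case by (simp add: assms(1))
next
  case (update f a b)
  have "Poly_Mapping.update a b f = Poly_Mapping.single a b + f"
    using update by (intro poly_mapping_eqI)
      (auto simp: lookup_update lookup_add lookup_single when_def in_keys_iff)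
  with update assms show ?case by metis
qed

lemma partial_mult_single:
  fixes v :: "'n \<times> 'n" and c c' :: complex
  shows "partial v (Poly_Mapping.single m c * Poly_Mapping.single m' c') =
     partial v (Poly_Mapping.single m c) * Poly_Mapping.single m' c' +
     Poly_Mapping.single m c * partial v (Poly_Mapping.single m' c')"
proof -
  let ?e = "Poly_Mapping.single v (1::nat)"
  have shift: "m - ?e + m' = m + m' - ?e" if "Poly_Mapping.lookup m v \<noteq> 0"
    for m m' :: "('n \<times> 'n) \<Rightarrow>\<^sub>0 nat"
    using that by (intro poly_mapping_eqI) (auto simp: lookup_add lookup_minus lookup_single when_def)
  have 1: "Poly_Mapping.single (m - ?e + m') (of_nat (Poly_Mapping.lookup m v) * c * c') =
        Poly_Mapping.single (m + m' - ?e) (of_nat (Poly_Mapping.lookup m v) * c * c')"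
    using shift[of m m'] by (cases "Poly_Mapping.lookup m v = 0") auto
  have 2: "Poly_Mapping.single (m + (m' - ?e)) (c * (of_nat (Poly_Mapping.lookup m' v) * c')) =
        Poly_Mapping.single (m + m' - ?e) (c * (of_nat (Poly_Mapping.lookup m' v) * c'))"
    using shift[of m' m] by (cases "Poly_Mapping.lookup m' v = 0") (auto simp: add.commute)
  show ?thesis
    by (simp only: partial_single mult_single 1 2 flip: single_add)
       (simp add: lookup_add algebra_simps)
qed

lemma partial_mult: "partial v (f * g) = partial v f * g + f * partial v g"
proof (induction f rule: sym_gl_induct)
  case (single m c)
  show ?case
    by (induction g rule: sym_gl_induct)
       (simp_all add: partial_mult_single partial_add ring_distribs)
qed (simp_all add: partial_add ring_distribs)

lemma biderivation_var: "biderivation c (var u) (var v) = c u v"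
proof -
  have "biderivation c (var u) (var v) =
      (\<Sum>u' \<in> UNIV. \<Sum>v' \<in> UNIV. if v' = v then (if u' = u then c u' v' else 0) else 0)"
    unfolding biderivation_def by (intro sum.cong refl) (simp add: partial_var)
  then show ?thesis by simp
qed

lemma biderivation_const:
  "biderivation c (const a) g = 0" "biderivation c f (const a) = 0"
  by (simp_all add: biderivation_def)

lemma biderivation_add:
  "biderivation c (f + f') g = biderivation c f g + biderivation c f' g"
  "biderivation c f (g + g') = biderivation c f g + biderivation c f g'"
  by (simp_all add: biderivation_def partial_add ring_distribs sum.distrib)

lemma biderivation_mult:
  "biderivation c (f * f') g = f * biderivation c f' g + f' * biderivation c f g"
  "biderivation c f (g * g') = g * biderivation c f g' + g' * biderivation c f g"
  by (simp_all add: biderivation_def partial_mult ring_distribs sum.distrib sum_distrib_left mult_ac)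

section \<open>The Poisson pencil\<close>

definition gl_bracket :: "'n::finite sym_gl \<Rightarrow> 'n sym_gl \<Rightarrow> 'n sym_gl"
  where "gl_bracket = biderivation (\<lambda>(i, j) (k, s).
     (if k = j then var (i, s) else 0) - (if i = s then var (k, j) else 0))"

definition gen_matrix :: "'n::finite sym_gl ^ 'n ^ 'n"
  where "gen_matrix = (\<chi> i j. var (i, j))"

text \<open>The matrix \<open>{L\<^sub>1, L\<^sub>2}\<^sub>r\<close>; scalar matrices act on matrices over Sym(gl(N)) through the
  embedding \<open>const\<close>.\<close>

definition r_bracket_matrix :: "'n::finite op2 \<Rightarrow> 'n sym_gl ^ ('n \<times> 'n) ^ ('n \<times> 'n)"
  where "r_bracket_matrix r =
    (let L\<^sub>1 = kronecker gen_matrix (mat 1);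
         L\<^sub>2 = kronecker (mat 1) gen_matrix;
         r\<^sub>1\<^sub>2 = map_matrix const r;
         r\<^sub>2\<^sub>1 = map_matrix const (flip ** r ** flip)
     in r\<^sub>2\<^sub>1 ** L\<^sub>1 ** L\<^sub>2 - L\<^sub>1 ** L\<^sub>2 ** r\<^sub>1\<^sub>2 + L\<^sub>2 ** r\<^sub>1\<^sub>2 ** L\<^sub>1 - L\<^sub>1 ** r\<^sub>2\<^sub>1 ** L\<^sub>2)"

text \<open>As the entry of \<open>L \<otimes> L\<close> in row \<open>(i, k)\<close> and column \<open>(j, s)\<close> is \<open>l_i^j l_k^s\<close>, that entry of
  the bracket matrix is \<open>{l_i^j, l_k^s}\<^sub>r\<close>.\<close>

definition r_bracket :: "'n::finite op2 \<Rightarrow> 'n sym_gl \<Rightarrow> 'n sym_gl \<Rightarrow> 'n sym_gl"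
  where "r_bracket r = biderivation (\<lambda>(i, j) (k, s). r_bracket_matrix r $ (i, k) $ (j, s))"

definition pencil ::
    "'n::finite op2 \<Rightarrow> complex \<Rightarrow> complex \<Rightarrow> 'n sym_gl \<Rightarrow> 'n sym_gl \<Rightarrow> 'n sym_gl"
  where "pencil r a b f g = const a * gl_bracket f g + const b * r_bracket r f g"

section \<open>Orbits and Poisson ideals\<close>

definition gl_orbit :: "complex ^ 'n ^ 'n \<Rightarrow> (complex ^ 'n::finite ^ 'n) set"
  where "gl_orbit M = {g ** M ** matrix_inv g | g. invertible g}"

definition generic_orbit :: "(complex ^ 'n::finite ^ 'n) set \<Rightarrow> bool"
  where "generic_orbit X \<longleftrightarrow>
     (\<exists>\<mu> :: 'n \<Rightarrow> complex. inj \<mu> \<and> X = gl_orbit (\<chi> i j. if i = j then \<mu> i else 0))"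

definition vanishing_ideal :: "(complex ^ 'n ^ 'n) set \<Rightarrow> 'n::finite sym_gl set"
  where "vanishing_ideal X = {f. \<forall>x \<in> X. eval_at x f = 0}"

definition poisson_ideal :: "('a::comm_ring_1 \<Rightarrow> 'a \<Rightarrow> 'a) \<Rightarrow> 'a set \<Rightarrow> bool"
  where "poisson_ideal B J \<longleftrightarrow>
     0 \<in> J \<and> (\<forall>f \<in> J. \<forall>g \<in> J. f + g \<in> J) \<and> (\<forall>f \<in> J. \<forall>g. g * f \<in> J) \<and>
     (\<forall>f \<in> J. \<forall>g. B f g \<in> J)"

end

theory Submission
  imports Defs
begin

text \<open>
  Let \<open>f\<close> vanish on the orbit through \<open>x\<close>. Differentiating \<open>f\<close> along the curves
  \<open>T(t) x T(t)\<^sup>-\<^sup>1\<close> with \<open>T(t) = I + t E\<^sub>a\<^sub>b\<close> shows that the gradient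
  \<open>G\<close> of \<open>f\<close> at \<open>x\<close>, taken with respect to the trace form, commutes with \<open>x\<close>. The values at
  \<open>x\<close> of the brackets of \<open>f\<close> with the generators are the entries of the partial trace
  \<open>Tr\<^sub>1(G\<^sub>1 {L\<^sub>1, L\<^sub>2})\<close>. When \<open>G\<close> commutes with \<open>L = x\<close>, cyclicity of the partial trace
  with respect to operators of the form \<open>A \<otimes> I\<close> makes the four terms of the \<open>r\<close>-bracket
  cancel in pairs, and the linear bracket yields \<open>G L - L G = 0\<close>.
\<close>

section \<open>Evaluation of polynomials\<close>

lemma eval_at_superset:
  assumes "finite S" "Poly_Mapping.keys f \<subseteq> S"
  shows "eval_at x f = (\<Sum>m \<in> S. Poly_Mapping.lookup f m *
    (\<Prod>v \<in> UNIV. (x $ fst v $ snd v) ^ Poly_Mapping.lookup m v))"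
  unfolding eval_at_def case_prod_unfold
  by (rule sum.mono_neutral_cong_left) (use assms in \<open>auto simp: in_keys_iff\<close>)

lemma eval_at_0 [simp]: "eval_at x 0 = 0"
  by (simp add: eval_at_def)

lemma eval_at_single:
  "eval_at x (Poly_Mapping.single m c) =
     c * (\<Prod>v \<in> UNIV. (x $ fst v $ snd v) ^ Poly_Mapping.lookup m v)"
  by (subst eval_at_superset[of "{m}"]) auto

lemma eval_at_add: "eval_at x (f + g) = eval_at x f + eval_at x g"
proof -
  let ?S = "Poly_Mapping.keys f \<union> Poly_Mapping.keys g"
  have S: "finite ?S" "Poly_Mapping.keys f \<subseteq> ?S" "Poly_Mapping.keys g \<subseteq> ?S"
      "Poly_Mapping.keys (f + g) \<subseteq> ?S"
    by (auto simp: keys_add)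
  show ?thesis
    unfolding eval_at_superset[OF S(1,2)] eval_at_superset[OF S(1,3)] eval_at_superset[OF S(1,4)]
    by (simp add: lookup_add ring_distribs sum.distrib)
qed

lemma eval_at_mult: "eval_at x (f * g) = eval_at x f * eval_at x g"
proof (induction f rule: sym_gl_induct)
  case (single m c)
  show ?case
    by (induction g rule: sym_gl_induct)
       (simp_all add: eval_at_single mult_single lookup_add power_add prod.distrib eval_at_add
          ring_distribs)
qed (simp_all add: eval_at_add ring_distribs)

lemma eval_at_minus: "eval_at x (f - g) = eval_at x f - eval_at x g"
  using eval_at_add[of x "f - g" g] by simp

lemma eval_at_sum: "eval_at x (sum F A) = (\<Sum>a \<in> A. eval_at x (F a))"
  by (induction A rule: infinite_finite_induct) (simp_all add: eval_at_add)

lemma eval_at_const [simp]: "eval_at x (const c) = c"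
  by (simp add: const_def eval_at_single)

lemma eval_at_1 [simp]: "eval_at x 1 = 1"
  using eval_at_const[of x 1] by (simp add: const_def)

lemma eval_at_var [simp]: "eval_at x (var v) = x $ fst v $ snd v"
proof -
  have "(\<Prod>w \<in> UNIV. (x $ fst w $ snd w) ^ Poly_Mapping.lookup (Poly_Mapping.single v 1) w) =
      (\<Prod>w \<in> UNIV. if w = v then x $ fst w $ snd w else 1)"
    by (intro prod.cong refl) (auto simp: lookup_single when_def)
  then show ?thesis
    by (simp add: var_def eval_at_single)
qed

text \<open>The chain rule, by induction over sums of monomials. It ties the formal
  \<open>partial\<close> to analytic derivatives along curves of matrices.\<close>

lemma has_field_derivative_eval_at:
  fixes \<gamma> :: "complex \<Rightarrow> complex ^ 'n ^ 'n::finite"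
  assumes "\<And>i j. ((\<lambda>t. \<gamma> t $ i $ j) has_field_derivative D $ i $ j) (at t)"
  shows "((\<lambda>t. eval_at (\<gamma> t) f) has_field_derivative
    (\<Sum>v \<in> UNIV. eval_at (\<gamma> t) (partial v f) * D $ fst v $ snd v)) (at t)"
proof (induction f rule: sym_gl_induct)
  case zero
  show ?case by simp
next
  case (single m c)
  let ?k = "Poly_Mapping.lookup m" and ?y = "\<lambda>v t. \<gamma> t $ fst v $ snd v"
  \<comment> \<open>Subtraction of exponents truncates at 0, so the identity also holds for
    \<open>?k w = 0\<close>; the derivative then carries the factor \<open>of_nat 0\<close>.\<close>
  have step: "((\<Prod>v \<in> UNIV. ?y v t ^ Poly_Mapping.lookup (m - Poly_Mapping.single w 1) v) =
      ?y w t ^ (?k w - 1) * (\<Prod>v \<in> UNIV - {w}. ?y v t ^ ?k v))" for w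
    by (subst prod.remove[of _ w])
       (auto simp: lookup_minus lookup_single when_def intro!: prod.cong)
  have "((\<lambda>t. \<Prod>v \<in> UNIV. ?y v t ^ ?k v) has_field_derivative
      (\<Sum>v \<in> UNIV. of_nat (?k v) * (D $ fst v $ snd v * ?y v t ^ (?k v - Suc 0)) *
        (\<Prod>w \<in> UNIV - {v}. ?y w t ^ ?k w))) (at t)"
    by (intro has_field_derivative_prod DERIV_power assms)
  then have "((\<lambda>t. c * (\<Prod>v \<in> UNIV. ?y v t ^ ?k v)) has_field_derivative
      c * (\<Sum>v \<in> UNIV. of_nat (?k v) * (D $ fst v $ snd v * ?y v t ^ (?k v - Suc 0)) *
        (\<Prod>w \<in> UNIV - {v}. ?y w t ^ ?k w))) (at t)"
    by (rule DERIV_cmult)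
  then show ?case
    unfolding eval_at_single partial_single step
    by (simp add: sum_distrib_left mult_ac)
next
  case (add f g)
  from DERIV_add[OF add] show ?case
    by (simp add: eval_at_add partial_add ring_distribs sum.distrib)
qed

section \<open>Gradients of functions vanishing on an orbit\<close>

text \<open>The indices are transposed so that the differential of \<open>f\<close> at
  \<open>x\<close> in direction \<open>D\<close> is Tr(G D).\<close>

definition gradient :: "complex ^ 'n ^ 'n \<Rightarrow> 'n::finite sym_gl \<Rightarrow> complex ^ 'n ^ 'n"
  where "gradient x f = (\<chi> j i. eval_at x (partial (i, j) f))"

text \<open>The case \<open>a = b\<close> is included; the matrix is then diagonal and singular at
  \<open>t = - 1\<close>.\<close>

definition transvection :: "'n \<Rightarrow> 'n \<Rightarrow> complex \<Rightarrow> complex ^ 'n ^ 'n::finite"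
  where "transvection a b t =
    (\<chi> i j. (if i = j then 1 else 0) + (if i = a \<and> j = b then t else 0))"

lemma transvection_mult_left:
  "(transvection a b t ** A) $ i $ j = A $ i $ j + (if i = a then t * A $ b $ j else 0)"
  by (simp add: transvection_def matrix_matrix_mult_def ring_distribs sum.distrib
      if_distrib[of "\<lambda>c. c * _"] cong: if_cong)

lemma transvection_mult_right:
  "(A ** transvection a b t) $ i $ j = A $ i $ j + (if j = b then A $ i $ a * t else 0)"
  by (simp add: transvection_def matrix_matrix_mult_def ring_distribs sum.distrib
      if_distrib[of "\<lambda>c. _ * c"] cong: if_cong)

text \<open>The matrix unit E with its 1 in place (a, b) squares to E if \<open>a = b\<close> and to
  0 otherwise, which gives the extra term \<open>s * t\<close>.\<close>

lemma transvection_mult: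
  "transvection a b s ** transvection a b t =
     transvection a b (s + t + (if a = b then s * t else 0))"
  by (simp add: vec_eq_iff transvection_mult_left) (auto simp: transvection_def algebra_simps)

lemma transvection_0: "transvection a b 0 = mat 1"
  by (simp add: transvection_def mat_def vec_eq_iff)

text \<open>\<open>matrix_inv\<close> is a Hilbert choice, but the choice is forced: a right inverse
  B' satisfies B' = B A B' = B.\<close>

lemma matrix_inv_unique:
  fixes A :: "'a::semiring_1 ^ 'n ^ 'm"
  assumes "A ** B = mat 1" "B ** A = mat 1"
  shows "matrix_inv A = B"
proof -
  have "B' = B" if "A ** B' = mat 1" for B'
    by (metis assms(2) matrix_mul_assoc matrix_mul_lid matrix_mul_rid that)
  with assms show ?thesis
    unfolding matrix_inv_def by (intro some_equality) blast+
qed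

text \<open>Used to keep the conjugation curves inside the orbit.\<close>

lemma gl_orbit_conjugate:
  assumes x: "x \<in> gl_orbit M" and "S ** T = mat 1" "T ** S = mat 1"
  shows "S ** x ** T \<in> gl_orbit M"
proof -
  obtain g h where g: "g ** h = mat 1" "h ** g = mat 1" and x: "x = g ** M ** h"
    using x unfolding gl_orbit_def invertible_def by (auto simp: matrix_inv_unique)
  have inv: "(S ** g) ** (h ** T) = mat 1"
    by (metis assms(2) g(1) matrix_mul_assoc matrix_mul_rid)
  have inv': "(h ** T) ** (S ** g) = mat 1"
    by (metis assms(3) g(2) matrix_mul_assoc matrix_mul_rid)
  have "S ** x ** T = (S ** g) ** M ** matrix_inv (S ** g)"
    unfolding matrix_inv_unique[OF inv inv'] x by (simp add: matrix_mul_assoc)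
  moreover have "invertible (S ** g)"
    using inv inv' by (auto simp: invertible_def)
  ultimately show ?thesis
    by (auto simp: gl_orbit_def)
qed

lemma gradient_commute:
  assumes x: "x \<in> gl_orbit M" and f: "f \<in> vanishing_ideal (gl_orbit M)"
  shows "gradient x f ** x = x ** gradient x f"
proof -
  have "(gradient x f ** x) $ b $ a = (x ** gradient x f) $ b $ a" for a b
  proof -
    \<comment> \<open>With E the matrix unit at (a, b), E E = d E; thus \<open>d\<close> treats
      diagonal and off-diagonal directions together.\<close>
    define d :: complex where "d = (if a = b then 1 else 0)"
    \<comment> \<open>chosen so that \<open>I + u(t) E\<^sub>a\<^sub>b\<close> is the inverse of \<open>I + t E\<^sub>a\<^sub>b\<close>\<close>
    define u where "u t = - t / (1 + d * t)" for t
    define \<gamma> where "\<gamma> t = transvection a b t ** x ** transvection a b (u t)" for t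
    \<comment> \<open>The commutator E x - x E, which is the velocity of \<gamma> at 0.\<close>
    define D :: "complex ^ 'a ^ 'a" where
      "D = (\<chi> i j. (if i = a then x $ b $ j else 0) - (if j = b then x $ i $ a else 0))"
    have \<gamma>0: "\<gamma> 0 = x"
      by (simp add: \<gamma>_def u_def transvection_0)
    have u': "(u has_field_derivative - 1) (at 0)"
      unfolding u_def by (auto intro!: derivative_eq_intros)
    have "((\<lambda>t. \<gamma> t $ i $ j) has_field_derivative D $ i $ j) (at 0)" for i j
      unfolding \<gamma>_def transvection_mult_left transvection_mult_right D_def
      by (cases "i = a"; cases "j = b")
         (auto intro!: derivative_eq_intros u' simp: u_def)
    from has_field_derivative_eval_at[OF this]
    have "((\<lambda>t. eval_at (\<gamma> t) f) has_field_derivative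
        (\<Sum>v \<in> UNIV. eval_at x (partial v f) * D $ fst v $ snd v)) (at 0)"
      by (simp add: \<gamma>0)
    \<comment> \<open>Near 0 the denominator of \<open>u\<close> is nonzero, so the curve stays in
      the orbit and \<open>f\<close> is constantly 0 along it.\<close>
    moreover have "((\<lambda>t. eval_at (\<gamma> t) f) has_field_derivative 0) (at 0)"
    proof (rule has_field_derivative_transform_within_open)
      show "((\<lambda>t. 0) has_field_derivative 0) (at 0)" by simp
      show "open {t. 1 + d * t \<noteq> 0}"
        by (intro open_Collect_neq continuous_intros)
      fix t assume "t \<in> {t. 1 + d * t \<noteq> 0}"
      then have t: "1 + d * t \<noteq> 0" by simp
      have "t + u t + (if a = b then t * u t else 0) = 0"
        using t by (auto simp: u_def d_def divide_simps split: if_splits) (simp_all add: algebra_simps)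
      then have "transvection a b t ** transvection a b (u t) = mat 1"
        "transvection a b (u t) ** transvection a b t = mat 1"
        by (simp_all add: transvection_mult add.commute mult.commute transvection_0 cong: if_cong)
      then have "\<gamma> t \<in> gl_orbit M"
        unfolding \<gamma>_def by (rule gl_orbit_conjugate[OF x])
      then show "0 = eval_at (\<gamma> t) f"
        using f by (simp add: vanishing_ideal_def)
    qed auto
    ultimately have "(\<Sum>v \<in> UNIV. eval_at x (partial v f) * D $ fst v $ snd v) = 0"
      by (rule DERIV_unique)
    \<comment> \<open>With G the gradient, Tr(G (E x - x E)) = Tr(E (x G - G x)) is the entry (b, a)
      of x G - G x.\<close>
    then have "0 = (\<Sum>i \<in> UNIV. \<Sum>j \<in> UNIV. gradient x f $ j $ i * D $ i $ j)"
      by (simp add: gradient_def sum.cartesian_product case_prod_unfold)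
    also have "\<dots> = (\<Sum>i \<in> UNIV. \<Sum>j \<in> UNIV. if i = a then gradient x f $ j $ i * x $ b $ j else 0) -
        (\<Sum>i \<in> UNIV. \<Sum>j \<in> UNIV. if j = b then gradient x f $ j $ i * x $ i $ a else 0)"
      unfolding D_def sum_subtractf[symmetric]
      by (intro sum.cong refl) (auto simp: right_diff_distrib)
    also have "(\<Sum>i \<in> UNIV. \<Sum>j \<in> UNIV. if i = a then gradient x f $ j $ i * x $ b $ j else 0) =
        (\<Sum>j \<in> UNIV. gradient x f $ j $ a * x $ b $ j)"
      by (subst sum.swap) simp
    finally show ?thesis
      by (simp add: matrix_matrix_mult_def mult.commute)
  qed
  then show ?thesis
    by (simp add: vec_eq_iff)
qed

section \<open>Partial traces\<close>

text \<open>\<open>Tr\<^sub>1((C \<otimes> I) M)\<close>\<close>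

definition partial_trace :: "'a::comm_ring_1 ^ 'n ^ 'n \<Rightarrow> 'a ^ ('n \<times> 'n) ^ ('n \<times> 'n) \<Rightarrow> 'a ^ 'n ^ 'n::finite"
  where "partial_trace C M = (\<chi> k s. \<Sum>i \<in> UNIV. \<Sum>j \<in> UNIV. C $ j $ i * M $ (i, k) $ (j, s))"

lemma sum_UNIV_prod:
  "(\<Sum>p \<in> (UNIV :: ('a::finite \<times> 'b::finite) set). F p) = (\<Sum>i \<in> UNIV. \<Sum>j \<in> UNIV. F (i, j))"
  by (simp add: sum.cartesian_product case_prod_unfold)

lemma kronecker_mat_1_right_mult:
  "(kronecker A (mat 1) ** M) $ (i, k) $ p = (\<Sum>a \<in> UNIV. A $ i $ a * M $ (a, k) $ p)"
  for M :: "'a::comm_ring_1 ^ 'm ^ ('n::finite \<times> 'n::finite)"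
  by (simp add: matrix_matrix_mult_def sum_UNIV_prod kronecker_def mat_def
      if_distrib[of "\<lambda>c. _ * c"] if_distrib[of "\<lambda>c. c * _"] cong: if_cong)

lemma mult_kronecker_mat_1_right:
  "(M ** kronecker A (mat 1)) $ p $ (j, s) = (\<Sum>a \<in> UNIV. M $ p $ (a, s) * A $ a $ j)"
  for M :: "'a::comm_ring_1 ^ ('n::finite \<times> 'n::finite) ^ 'm"
  by (simp add: matrix_matrix_mult_def sum_UNIV_prod kronecker_def mat_def
      if_distrib[of "\<lambda>c. _ * c"] if_distrib[of "\<lambda>c. c * _"] cong: if_cong)

lemma kronecker_mat_1_left_mult:
  "(kronecker (mat 1) A ** M) $ (i, k) $ p = (\<Sum>b \<in> UNIV. A $ k $ b * M $ (i, b) $ p)"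
  for M :: "'a::comm_ring_1 ^ 'm ^ ('n::finite \<times> 'n::finite)"
  by (simp add: matrix_matrix_mult_def sum_UNIV_prod kronecker_def mat_def sum.swap[of _ "UNIV :: 'n set"]
      if_distrib[of "\<lambda>c. _ * c"] if_distrib[of "\<lambda>c. c * _"] cong: if_cong)

lemma mult_kronecker_mat_1_left:
  "(M ** kronecker (mat 1) A) $ p $ (j, s) = (\<Sum>b \<in> UNIV. M $ p $ (j, b) * A $ b $ s)"
  for M :: "'a::comm_ring_1 ^ ('n::finite \<times> 'n::finite) ^ 'm"
  by (simp add: matrix_matrix_mult_def sum_UNIV_prod kronecker_def mat_def sum.swap[of _ "UNIV :: 'n set"]
      if_distrib[of "\<lambda>c. _ * c"] if_distrib[of "\<lambda>c. c * _"] cong: if_cong)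

lemma partial_trace_1_left: "partial_trace C (kronecker A (mat 1) ** M) = partial_trace (C ** A) M"
proof -
  have "(\<Sum>i \<in> UNIV. \<Sum>j \<in> UNIV. \<Sum>a \<in> UNIV. C $ j $ i * (A $ i $ a * M $ (a, k) $ (j, s))) =
      (\<Sum>a \<in> UNIV. \<Sum>j \<in> UNIV. \<Sum>i \<in> UNIV. C $ j $ i * (A $ i $ a * M $ (a, k) $ (j, s)))" for k s
    by (subst sum.swap, subst (2) sum.swap, subst sum.swap) (rule refl)
  then show ?thesis
    unfolding partial_trace_def kronecker_mat_1_right_mult
    by (simp add: matrix_matrix_mult_def vec_eq_iff
        sum_distrib_left sum_distrib_right mult.assoc)
qed

text \<open>Cyclicity of the trace in the first tensor factor.\<close>

lemma partial_trace_1_right: "partial_trace C (M ** kronecker A (mat 1)) = partial_trace (A ** C) M"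
proof -
  have "(\<Sum>j \<in> UNIV. \<Sum>a \<in> UNIV. C $ j $ i * (M $ (i, k) $ (a, s) * A $ a $ j)) =
      (\<Sum>a \<in> UNIV. \<Sum>j \<in> UNIV. A $ a $ j * C $ j $ i * M $ (i, k) $ (a, s))" for i k s
    by (subst sum.swap) (simp add: mult_ac)
  then show ?thesis
    unfolding partial_trace_def mult_kronecker_mat_1_right
    by (simp add: matrix_matrix_mult_def vec_eq_iff
        sum_distrib_left sum_distrib_right)
qed

text \<open>The trace does not touch the second factor, so operators on that factor pass through it,
  here on the left and below on the right.\<close>

lemma partial_trace_2_left: "partial_trace C (kronecker (mat 1) A ** M) = A ** partial_trace C M"
proof -
  have "(\<Sum>i \<in> UNIV. \<Sum>j \<in> UNIV. \<Sum>b \<in> UNIV. C $ j $ i * (A $ k $ b * M $ (i, b) $ (j, s))) =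
      (\<Sum>b \<in> UNIV. \<Sum>i \<in> UNIV. \<Sum>j \<in> UNIV. A $ k $ b * (C $ j $ i * M $ (i, b) $ (j, s)))" for k s
    by (subst (2) sum.swap, subst sum.swap) (simp add: mult_ac)
  then show ?thesis
    unfolding partial_trace_def kronecker_mat_1_left_mult
    by (simp add: matrix_matrix_mult_def vec_eq_iff
        sum_distrib_left)
qed

lemma partial_trace_2_right: "partial_trace C (M ** kronecker (mat 1) A) = partial_trace C M ** A"
proof -
  have "(\<Sum>i \<in> UNIV. \<Sum>j \<in> UNIV. \<Sum>b \<in> UNIV. C $ j $ i * (M $ (i, k) $ (j, b) * A $ b $ s)) =
      (\<Sum>b \<in> UNIV. \<Sum>i \<in> UNIV. \<Sum>j \<in> UNIV. C $ j $ i * M $ (i, k) $ (j, b) * A $ b $ s)" for k s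
    by (subst (2) sum.swap, subst sum.swap) (simp add: mult_ac)
  then show ?thesis
    unfolding partial_trace_def mult_kronecker_mat_1_left
    by (simp add: matrix_matrix_mult_def vec_eq_iff
        sum_distrib_left sum_distrib_right)
qed

lemma partial_trace_add: "partial_trace C (M + M') = partial_trace C M + partial_trace C M'"
  by (simp add: partial_trace_def vec_eq_iff ring_distribs sum.distrib)

lemma partial_trace_diff: "partial_trace C (M - M') = partial_trace C M - partial_trace C M'"
  by (simp add: partial_trace_def vec_eq_iff right_diff_distrib sum_subtractf)

lemma partial_trace_r_bracket:
  assumes "C ** L = L ** C"
  shows "partial_trace C
    (s ** kronecker L (mat 1) ** kronecker (mat 1) L - kronecker L (mat 1) ** kronecker (mat 1) L ** r +
     kronecker (mat 1) L ** r ** kronecker L (mat 1) - kronecker L (mat 1) ** s ** kronecker (mat 1) L) = 0"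
  \<comment> \<open>Regroups the second term so that the factor acting on the first space stands
    outermost on the left, where \<open>partial_trace_1_left\<close> applies.\<close>
  unfolding matrix_mul_assoc[symmetric, of "kronecker L (mat 1)" "kronecker (mat 1) L" r]
  by (simp add: partial_trace_add partial_trace_diff partial_trace_1_left partial_trace_1_right
      partial_trace_2_left partial_trace_2_right assms)

section \<open>The brackets at a point\<close>

text \<open>Evaluation is a ring homomorphism, so it commutes with matrix operations; these lemmas
  turn \<open>r_bracket_matrix\<close> at \<open>x\<close> into the same expression in the numerical
  matrix \<open>x\<close>.\<close>

lemma eval_at_matrix_mult:
  "map_matrix (eval_at x) (A ** B) = map_matrix (eval_at x) A ** map_matrix (eval_at x) B"
  by (simp add: vec_eq_iff map_matrix_def matrix_matrix_mult_def eval_at_sum eval_at_mult)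

lemma eval_at_matrix_add:
  "map_matrix (eval_at x) (A + B) = map_matrix (eval_at x) A + map_matrix (eval_at x) B"
  by (simp add: vec_eq_iff map_matrix_def eval_at_add)

lemma eval_at_matrix_diff:
  "map_matrix (eval_at x) (A - B) = map_matrix (eval_at x) A - map_matrix (eval_at x) B"
  by (simp add: vec_eq_iff map_matrix_def eval_at_minus)

lemma eval_at_matrix_kronecker:
  "map_matrix (eval_at x) (kronecker A B) = kronecker (map_matrix (eval_at x) A) (map_matrix (eval_at x) B)"
  by (simp add: vec_eq_iff map_matrix_def kronecker_def eval_at_mult)

lemma eval_at_matrix_1: "map_matrix (eval_at x) (mat 1) = mat 1"
  by (simp add: vec_eq_iff map_matrix_def mat_def)

lemma eval_at_matrix_const: "map_matrix (eval_at x) (map_matrix const A) = A"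
  by (simp add: vec_eq_iff map_matrix_def)

lemma eval_at_gen_matrix: "map_matrix (eval_at x) gen_matrix = x"
  by (simp add: vec_eq_iff map_matrix_def gen_matrix_def)

text \<open>The inner double sum is the value at \<open>x\<close> of the bracket of \<open>f\<close>
  with the generator indexed by (k, s), so it suffices to make these sums vanish.\<close>

lemma eval_at_biderivation:
  "eval_at x (biderivation c f g) = (\<Sum>(k, s) \<in> UNIV. eval_at x (partial (k, s) g) *
     (\<Sum>i \<in> UNIV. \<Sum>j \<in> UNIV. gradient x f $ j $ i * eval_at x (c (i, j) (k, s))))"
proof -
  have "eval_at x (biderivation c f g) =
      (\<Sum>v \<in> UNIV. \<Sum>u \<in> UNIV. eval_at x (partial u f) * eval_at x (partial v g) * eval_at x (c u v))"
    unfolding biderivation_def by (subst sum.swap) (simp add: eval_at_sum eval_at_mult)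
  then show ?thesis
    by (simp add: sum_UNIV_prod gradient_def sum_distrib_left mult_ac)
qed

text \<open>The index placement in \<open>r_bracket\<close> matches \<open>partial_trace\<close>, so
  the inner sums are the entries of one partial trace.\<close>

lemma r_bracket_vanishes:
  assumes "gradient x f ** x = x ** gradient x f"
  shows "eval_at x (r_bracket r f g) = 0"
proof -
  have "partial_trace (gradient x f) (map_matrix (eval_at x) (r_bracket_matrix r)) = 0"
    using partial_trace_r_bracket[OF assms]
    by (simp add: r_bracket_matrix_def Let_def eval_at_matrix_mult eval_at_matrix_add
        eval_at_matrix_diff eval_at_matrix_kronecker eval_at_matrix_1 eval_at_matrix_const
        eval_at_gen_matrix)
  then have "(\<Sum>i \<in> UNIV. \<Sum>j \<in> UNIV. gradient x f $ j $ i *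
      eval_at x (r_bracket_matrix r $ (i, k) $ (j, s))) = 0" for k s
    by (simp add: vec_eq_iff partial_trace_def map_matrix_def)
  then show ?thesis
    by (simp add: r_bracket_def eval_at_biderivation)
qed

text \<open>Here the inner sum is the entry (k, s) of G x - x G, with G the gradient.\<close>

lemma gl_bracket_vanishes:
  assumes "gradient x f ** x = x ** gradient x f"
  shows "eval_at x (gl_bracket f g) = 0"
proof -
  have "(\<Sum>i \<in> UNIV. \<Sum>j \<in> UNIV. gradient x f $ j $ i *
      eval_at x ((if k = j then var (i, s) else 0) - (if i = s then var (k, j) else 0))) = 0" for k s
  proof -
    have "(\<Sum>i \<in> UNIV. \<Sum>j \<in> UNIV. gradient x f $ j $ i *
        eval_at x ((if k = j then var (i, s) else 0) - (if i = s then var (k, j) else 0))) =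
      (\<Sum>i \<in> UNIV. \<Sum>j \<in> UNIV. if k = j then gradient x f $ j $ i * x $ i $ s else 0) -
      (\<Sum>i \<in> UNIV. \<Sum>j \<in> UNIV. if i = s then gradient x f $ j $ i * x $ k $ j else 0)"
      unfolding sum_subtractf[symmetric]
      by (intro sum.cong refl) (auto simp: eval_at_minus right_diff_distrib)
    also have "(\<Sum>i \<in> UNIV. \<Sum>j \<in> UNIV. if i = s then gradient x f $ j $ i * x $ k $ j else 0) =
        (\<Sum>j \<in> UNIV. gradient x f $ j $ s * x $ k $ j)"
      by (subst sum.swap) simp
    also have "(\<Sum>i \<in> UNIV. \<Sum>j \<in> UNIV. if k = j then gradient x f $ j $ i * x $ i $ s else 0) -
        (\<Sum>j \<in> UNIV. gradient x f $ j $ s * x $ k $ j) =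
        (gradient x f ** x) $ k $ s - (x ** gradient x f) $ k $ s"
      by (simp add: matrix_matrix_mult_def mult.commute)
    finally show ?thesis
      by (simp add: assms)
  qed
  then show ?thesis
    by (simp add: gl_bracket_def eval_at_biderivation)
qed

text \<open>The gradient of \<open>f\<close> commutes with each orbit point, so both brackets of
  \<open>f\<close> with any \<open>g\<close> vanish on the orbit pointwise.\<close>

lemma poisson_ideal_pencil_gl_orbit:
  "poisson_ideal (pencil r a b) (vanishing_ideal (gl_orbit M))"
  unfolding poisson_ideal_def
proof (intro conjI ballI allI)
  fix f g assume f: "f \<in> vanishing_ideal (gl_orbit M)"
  show "pencil r a b f g \<in> vanishing_ideal (gl_orbit M)"
    unfolding vanishing_ideal_def
    by (auto simp: pencil_def eval_at_add eval_at_mult r_bracket_vanishes gl_bracket_vanishes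
        gradient_commute[OF _ f])
qed (auto simp: vanishing_ideal_def eval_at_add eval_at_mult)

theorem mainTheorem2:
  fixes Q :: "complex set"
    and R :: "complex \<Rightarrow> 'n::finite op2"
    and r :: "'n op2"
  assumes "\<And>q. q \<in> Q \<Longrightarrow> hecke_symmetry q (R q)"
    and "deformation_of_flip Q R"
    and "classical_r_matrix Q R r"
  shows "\<forall>X. generic_orbit X \<longrightarrow>
           (\<forall>a b. poisson_ideal (pencil r a b) (vanishing_ideal X))"
  using poisson_ideal_pencil_gl_orbit by (auto simp: generic_orbit_def)

end
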